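(* Let $\alpha>0$, $\lambda\in\mathbb{R}$, let $r\ge 0$ be an integer, and let $X_{\lambda,r}$ be the $r$-truncated degenerate Poisson random variable with parameter $\alpha$. Then, for $\lambda\neq-\frac{1}{\alpha}$, the expectation of $X_{\lambda,r}$ is given by $$E[X_{\lambda,r}]=\frac{1}{1+\alpha\lambda}\left[\alpha+\frac{\alpha^{r+1}}{r!}\,\frac{(1)_{r+1,\lambda}}{e_{\lambda}(\alpha)-e_{\lambda,r}(\alpha)}\right].$$
   Context: For $\lambda,x\in\mathbb{R}$ put $(x)_{0,\lambda}=1$ and $(x)_{n,\lambda}=x(x-\lambda)(x-2\lambda)\cdots(x-(n-1)\lambda)$ for $n\ge 1$. The degenerate exponential function is $e_{\lambda}(t)=(1+\lambda t)^{1/\lambda}=\sum_{k=0}^{\infty}(1)_{k,\lambda}\frac{t^k}{k!}$ (for $\lambda=0$, $e_0(t)=e^t$), and for an integer $r\ge 0$, $e_{\lambda,r}(t)=\sum_{k=0}^{r}(1)_{k,\lambda}\frac{t^k}{k!}$. The $r$-truncated degenerate Poisson random variable with parameter $\alpha>0$ is the random variable $X_{\lambda,r}$ taking values in $\{r+1,r+2,\dots\}$ with probability mass function $$p_{\lambda,r}(k)=P\{X_{\lambda,r}=k\}=\frac{(1)_{k,\lambda}}{e_{\lambda}(\alpha)-e_{\lambda,r}(\alpha)}\,\frac{\alpha^k}{k!},\qquad k=r+1,r+2,\dots.$$ To say that $X_{\lambda,r}$ is such a random variable presupposes that $\lambda,\alpha,r$ are such that this is a probability mass function: the series $\sum_k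 (1)_{k,\lambda}\alpha^k/k!$ converges to $e_\lambda(\alpha)$, the denominator $e_{\lambda}(\alpha)-e_{\lambda,r}(\alpha)$ is nonzero, and all values $p_{\lambda,r}(k)$ are nonnegative (so that they sum to $1$). *)

theory Defs
  imports "HOL-Probability.Probability"
begin

definition degen_fact :: "real \<Rightarrow> nat \<Rightarrow> real \<Rightarrow> real" where
  "degen_fact x n l = (\<Prod>i<n. x - real i * l)"

definition degen_exp :: "real \<Rightarrow> real \<Rightarrow> real" where
  "degen_exp l t = (if l = 0 then exp t else (1 + l * t) powr (1 / l))"

definition degen_exp_trunc :: "real \<Rightarrow> nat \<Rightarrow> real \<Rightarrow> real" where
  "degen_exp_trunc l r t = (\<Sum>k\<le>r. degen_fact 1 k l * t ^ k / fact k)"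

definition trunc_degen_poisson_mass :: "real \<Rightarrow> real \<Rightarrow> nat \<Rightarrow> nat \<Rightarrow> real" where
  "trunc_degen_poisson_mass \<alpha> l r k =
     degen_fact 1 k l / (degen_exp l \<alpha> - degen_exp_trunc l r \<alpha>) * (\<alpha> ^ k / fact k)"

text \<open>The parameters for which \<^const>\<open>trunc_degen_poisson_mass\<close> is a probability mass
  function on the integers greater than \<open>r\<close>. The first condition also keeps \<^const>\<open>powr\<close> away
  from negative bases: for \<open>l * \<alpha> < - 1\<close> the series diverges.\<close>

definition trunc_degen_poisson_params :: "real \<Rightarrow> real \<Rightarrow> nat \<Rightarrow> bool" where
  "trunc_degen_poisson_params \<alpha> l r \<longleftrightarrow>
     (\<lambda>k. degen_fact 1 k l * \<alpha> ^ k / fact k) sums degen_exp l \<alpha> \<and>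
     degen_exp l \<alpha> - degen_exp_trunc l r \<alpha> \<noteq> 0 \<and>
     (\<forall>k>r. 0 \<le> trunc_degen_poisson_mass \<alpha> l r k)"

text \<open>Measurability into \<open>count_space {r<..}\<close> includes that \<open>X\<close> takes values in \<open>{r<..}\<close>.\<close>

definition trunc_degen_poisson_rv ::
    "'a measure \<Rightarrow> ('a \<Rightarrow> nat) \<Rightarrow> real \<Rightarrow> real \<Rightarrow> nat \<Rightarrow> bool" where
  "trunc_degen_poisson_rv M X \<alpha> l r \<longleftrightarrow>
     trunc_degen_poisson_params \<alpha> l r \<and>
     X \<in> measurable M (count_space {r<..}) \<and>
     (\<forall>k>r. measure M {\<omega> \<in> space M. X \<omega> = k} = trunc_degen_poisson_mass \<alpha> l r k)"

end

theory Submission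
  imports Defs
begin

text \<open>Writing \<open>a k\<close> for the \<open>k\<close>-th term of the series of the degenerate exponential function, one has
  \<open>(k + 1) * a (k + 1) = \<alpha> * a k - \<alpha> * l * (k * a k)\<close>. Summation over \<open>k < N\<close> expresses
  \<open>(1 + \<alpha> * l) * (\<Sum>k<N. k * a k)\<close> by the partial sum of \<open>a\<close> and the boundary term \<open>N * a N\<close>.
  If \<open>1 + \<alpha> * l > 0\<close>, the identity bounds the partial sums of the eventually nonnegative
  series \<open>k * a k / D\<close>, where \<open>D\<close> is the normalising denominator, so the mean is finite; the
  identity at \<open>N = \<infinity>\<close> minus that at \<open>N = r + 1\<close> is the formula. If \<open>1 + \<alpha> * l \<le> 0\<close>, then \<open>k * a k\<close>
  is nondecreasing, so \<open>a\<close> dominates a multiple of the harmonic series and cannot be summable.\<close>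

text \<open>The law of \<open>X\<close> has density \<open>q\<close> with respect to counting
  measure, since the two agree on singletons. As \<open>f \<ge> 0\<close>, the given convergence is
  absolute, hence integrability.\<close>

lemma has_bochner_integral_nat_valued:
  fixes X :: "'a \<Rightarrow> nat" and f :: "nat \<Rightarrow> real"
  assumes "finite_measure M" and X: "X \<in> measurable M (count_space UNIV)"
    and f: "\<And>k. 0 \<le> f k"
    and s: "(\<lambda>k. measure M {\<omega> \<in> space M. X \<omega> = k} * f k) sums s"
  shows "has_bochner_integral M (\<lambda>\<omega>. f (X \<omega>)) s"
proof -
  interpret finite_measure M by fact
  define q where "q k = measure M {\<omega> \<in> space M. X \<omega> = k}" for k
  have q: "0 \<le> q k" for k by (simp add: q_def)
  have D: "distr M (count_space UNIV) X = density (count_space UNIV) (\<lambda>k. ennreal (q k))"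
  proof (rule measure_eqI_countable[of _ UNIV])
    fix k :: nat
    have "X -` {k} \<inter> space M = {\<omega> \<in> space M. X \<omega> = k}" by auto
    then show "emeasure (distr M (count_space UNIV) X) {k} =
        emeasure (density (count_space UNIV) (\<lambda>k. ennreal (q k))) {k}"
      using X by (simp add: emeasure_distr emeasure_density emeasure_eq_measure q_def
          nn_integral_count_space_indicator[symmetric] nn_integral_count_space_finite)
  qed auto
  have sm: "summable (\<lambda>k. norm (q k * f k))"
    using s f q by (auto simp: sums_iff q_def)
  then have i: "integrable (count_space UNIV) (\<lambda>k. q k * f k)"
    by (simp add: integrable_count_space_nat_iff)
  have "integrable (distr M (count_space UNIV) X) f"
    unfolding D using i q by (subst integrable_density) auto
  then have 1: "integrable M (\<lambda>\<omega>. f (X \<omega>))"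
    using X by (simp add: integrable_distr)
  have "integral\<^sup>L M (\<lambda>\<omega>. f (X \<omega>)) = integral\<^sup>L (distr M (count_space UNIV) X) f"
    using X by (simp add: integral_distr)
  also have "\<dots> = integral\<^sup>L (count_space UNIV) (\<lambda>k. q k * f k)"
    unfolding D using q by (subst integral_density) auto
  also have "\<dots> = s"
    using integral_count_space_nat[OF i] s by (simp add: sums_iff q_def)
  finally show ?thesis using 1 by (simp add: has_bochner_integral_iff)
qed

text \<open>Shifting the index in the sum of \<open>(k + 1) * a (k + 1)\<close> over
  \<open>k < n\<close> costs only \<open>n * a n\<close>, since the term at 0 vanishes.\<close>

lemma sum_of_nat_mult_recurrence:
  fixes a :: "nat \<Rightarrow> real"
  assumes "\<And>k. real (Suc k) * a (Suc k) = (c - d * real k) * a k"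
  shows "(1 + d) * (\<Sum>k<n. real k * a k) + real n * a n = c * (\<Sum>k<n. a k)"
proof (induction n)
  case (Suc n)
  then show ?case using assms[of n] by (simp add: algebra_simps del: of_nat_Suc)
qed simp

lemma sums_of_nat_mult_recurrence:
  fixes b :: "nat \<Rightarrow> real"
  assumes rec: "\<And>k. real (Suc k) * b (Suc k) = (c - d * real k) * b k"
    and b: "b sums A" and pos: "1 + d > 0" and nonneg: "\<And>k. k > r \<Longrightarrow> 0 \<le> b k"
  shows "(\<lambda>k. real k * b k) sums (c * A / (1 + d))"
proof -
  note id = sum_of_nat_mult_recurrence[OF rec]
  have Cb: "convergent (\<lambda>n. c * (\<Sum>k<n. b k))"
    using b unfolding sums_def by (intro convergentI[of _ "c * A"] tendsto_intros)
  then obtain K where K: "\<And>n. \<bar>c * (\<Sum>k<n. b k)\<bar> \<le> K"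
    using convergent_imp_Bseq[OF Cb] by (auto simp: Bseq_def)
  \<comment> \<open>The sign of \<open>b\<close> is known only beyond \<open>r\<close>, so the first
    \<open>Suc r\<close> terms are cut off.\<close>
  let ?g = "\<lambda>k. real (k + Suc r) * b (k + Suc r)"
  have "summable ?g"
  proof (rule bounded_imp_summable)
    show "0 \<le> ?g n" for n using nonneg[of "n + Suc r"] by simp
  next
    fix n
    have e: "(\<Sum>k\<le>n. ?g k) = (\<Sum>k<Suc n + Suc r. real k * b k) - (\<Sum>k<Suc r. real k * b k)"
      by (induction n) simp_all
    have "(1 + d) * (\<Sum>k<Suc n + Suc r. real k * b k) \<le> K"
      using id[of "Suc n + Suc r"] K[of "Suc n + Suc r"] nonneg[of "Suc n + Suc r"]
        mult_nonneg_nonneg[of "real (Suc n + Suc r)" "b (Suc n + Suc r)"] by linarith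
    then have "(\<Sum>k<Suc n + Suc r. real k * b k) \<le> K / (1 + d)"
      using pos by (simp add: field_simps)
    then show "(\<Sum>k\<le>n. ?g k) \<le> K / (1 + d) - (\<Sum>k<Suc r. real k * b k)"
      unfolding e by simp
  qed
  then have sm: "summable (\<lambda>k. real k * b k)"
    using summable_iff_shift[of "\<lambda>k. real k * b k" "Suc r"] by simp
  then obtain T where T: "(\<lambda>k. real k * b k) sums T" by (auto simp: summable_def)
  \<comment> \<open>The boundary term is the general term of a series now known to converge, so it
    tends to 0.\<close>
  have "(\<lambda>n. (1 + d) * (\<Sum>k<n. real k * b k) + real n * b n) \<longlonglongrightarrow> (1 + d) * T + 0"
    using T summable_LIMSEQ_zero[OF sm] unfolding sums_def by (intro tendsto_intros)
  moreover have "(\<lambda>n. c * (\<Sum>k<n. b k)) \<longlonglongrightarrow> c * A"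
    using b unfolding sums_def by (intro tendsto_intros)
  ultimately have "(1 + d) * T = c * A"
    unfolding id using LIMSEQ_unique by fastforce
  then have "T = c * A / (1 + d)" using pos by (simp add: field_simps)
  with T show ?thesis by simp
qed

text \<open>Here \<open>- d \<ge> 1\<close> makes the factor \<open>c - d * k\<close> at least
  \<open>k\<close>, which keeps \<open>k * a k\<close> above its value \<open>c * a 0\<close> at
  \<open>k = 1\<close>.\<close>

lemma not_summable_of_nat_mult_recurrence:
  fixes a :: "nat \<Rightarrow> real"
  assumes rec: "\<And>k. real (Suc k) * a (Suc k) = (c - d * real k) * a k"
    and "a 0 > 0" "c > 0" "1 + d \<le> 0"
  shows "\<not> summable a"
proof
  assume s: "summable a"
  have "c * a 0 \<le> real (Suc k) * a (Suc k)" for k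
  proof (induction k)
    case 0
    then show ?case using rec[of 0] by simp
  next
    case (Suc k)
    \<comment> \<open>The induction hypothesis also gives the sign of \<open>a (Suc k)\<close>, by
      which the comparison of factors is multiplied.\<close>
    moreover from Suc have "0 < real (Suc k) * a (Suc k)"
      using assms(2,3) by (metis less_le_trans mult_pos_pos)
    then have "0 < a (Suc k)" by (simp add: zero_less_mult_iff)
    moreover have "real (Suc k) * a (Suc k) \<le> (c - d * real (Suc k)) * a (Suc k)"
    proof (rule mult_right_mono)
      have "1 * real (Suc k) \<le> (- d) * real (Suc k)"
        using assms(4) by (intro mult_right_mono) auto
      then show "real (Suc k) \<le> c - d * real (Suc k)" using assms(3) by simp
    qed (use \<open>0 < a (Suc k)\<close> in simp)
    ultimately show ?case using rec[of "Suc k"] by linarith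
  qed
  then have le: "c * a 0 * inverse (real (Suc k)) \<le> a (Suc k)" for k
    by (simp add: field_simps)
  have "summable (\<lambda>k. c * a 0 * inverse (real (Suc k)))"
    by (rule summable_comparison_test'[of "\<lambda>k. a (Suc k)" 0])
      (use s le assms(2,3) summable_Suc_iff[of a] in auto)
  then have "summable (\<lambda>k. inverse (real (Suc k)))"
    using assms(2,3) summable_cmult_iff[of "c * a 0"] by auto
  then show False
    using not_summable_harmonic[where 'a = real] summable_Suc_iff[of "\<lambda>k. inverse (real k)"] by simp
qed

theorem theorem1:
  fixes M :: "'a measure" and X :: "'a \<Rightarrow> nat" and \<alpha> l :: real and r :: nat
  assumes "prob_space M"
    and "\<alpha> > 0"
    and "trunc_degen_poisson_rv M X \<alpha> l r"
    and "l \<noteq> - 1 / \<alpha>"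
  shows "integrable M (\<lambda>\<omega>. real (X \<omega>)) \<and>
    prob_space.expectation M (\<lambda>\<omega>. real (X \<omega>)) =
      1 / (1 + \<alpha> * l) *
        (\<alpha> + \<alpha> ^ (r + 1) / fact r *
          (degen_fact 1 (r + 1) l / (degen_exp l \<alpha> - degen_exp_trunc l r \<alpha>)))"
proof -
  interpret prob_space M by fact
  define a where "a k = degen_fact 1 k l * \<alpha> ^ k / fact k" for k
  define D where "D = degen_exp l \<alpha> - degen_exp_trunc l r \<alpha>"
  \<comment> \<open>\<open>b k\<close> is the probability of \<open>k\<close> only for
    \<open>k > r\<close>; keeping the terms up to \<open>r\<close> lets the recurrence start at
    0.\<close>
  define b where "b k = a k / D" for k
  have mass: "trunc_degen_poisson_mass \<alpha> l r k = b k" for k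
    by (simp add: trunc_degen_poisson_mass_def a_def b_def D_def)
  have a: "a sums degen_exp l \<alpha>" and D: "D \<noteq> 0" and nonneg: "\<And>k. k > r \<Longrightarrow> 0 \<le> b k"
    and X: "X \<in> measurable M (count_space {r<..})"
    and P: "\<And>k. k > r \<Longrightarrow> measure M {\<omega> \<in> space M. X \<omega> = k} = b k"
    using assms(3)
    unfolding trunc_degen_poisson_rv_def trunc_degen_poisson_params_def mass a_def D_def by auto
  have trunc: "degen_exp_trunc l r \<alpha> = (\<Sum>k<Suc r. a k)"
    by (simp only: degen_exp_trunc_def a_def lessThan_Suc_atMost)
  have rec: "real (Suc k) * a (Suc k) = (\<alpha> - \<alpha> * l * real k) * a k" for k
    by (simp add: a_def degen_fact_def field_simps del: of_nat_Suc)
  have recb: "real (Suc k) * b (Suc k) = (\<alpha> - \<alpha> * l * real k) * b k" for k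
    using rec[of k] by (simp add: b_def)
  have "a 0 = 1" by (simp add: a_def degen_fact_def)
  have "1 + \<alpha> * l > 0"
  proof (rule ccontr)
    assume "\<not> 1 + \<alpha> * l > 0"
    then have "\<not> summable a"
      using not_summable_of_nat_mult_recurrence[OF rec] assms(2) \<open>a 0 = 1\<close> by simp
    with a show False by (simp add: sums_iff)
  qed
  have b: "b sums (degen_exp l \<alpha> / D)"
    unfolding b_def by (intro sums_divide a)
  have kb: "(\<lambda>k. real k * b k) sums (\<alpha> * (degen_exp l \<alpha> / D) / (1 + \<alpha> * l))"
    by (rule sums_of_nat_mult_recurrence[OF recb b \<open>1 + \<alpha> * l > 0\<close> nonneg])
  have small: "measure M {\<omega> \<in> space M. X \<omega> = k} = 0" if "k \<le> r" for k
  proof -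
    have "{\<omega> \<in> space M. X \<omega> = k} = {}"
      using measurable_space[OF X] that by fastforce
    then show ?thesis by (simp only: measure_empty)
  qed
  let ?E = "\<alpha> * (degen_exp l \<alpha> / D) / (1 + \<alpha> * l) - (\<Sum>k<Suc r. real k * b k)"
  have "(\<lambda>k. real k * b k - (if k < Suc r then real k * b k else 0)) sums ?E"
    using sums_If_finite_set[of "{..<Suc r}" "\<lambda>k. real k * b k"]
    by (intro sums_diff kb) auto
  \<comment> \<open>Removing the head leaves 0 for \<open>k \<le> r\<close>, which matches the null
    events there.\<close>
  also have "(\<lambda>k. real k * b k - (if k < Suc r then real k * b k else 0)) =
      (\<lambda>k. measure M {\<omega> \<in> space M. X \<omega> = k} * real k)"
    using P small by (auto simp: fun_eq_iff not_less less_Suc_eq_le)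
  finally have s: "(\<lambda>k. measure M {\<omega> \<in> space M. X \<omega> = k} * real k) sums ?E" .
  have "X \<in> measurable M (count_space UNIV)"
    using measurable_compose[OF X, of "\<lambda>x. x" "count_space UNIV"] by simp
  from has_bochner_integral_nat_valued[OF finite_measure_axioms this _ s]
  have int: "has_bochner_integral M (\<lambda>\<omega>. real (X \<omega>)) ?E" by simp
  \<comment> \<open>The head is evaluated by the finite identity at \<open>Suc r\<close>, whose
    boundary term becomes the second summand of the formula.\<close>
  have "(1 + \<alpha> * l) * ?E = \<alpha> * (degen_exp l \<alpha> / D) - \<alpha> * (\<Sum>k<Suc r. b k) + real (Suc r) * b (Suc r)"
    using sum_of_nat_mult_recurrence[OF recb, of "Suc r"] \<open>1 + \<alpha> * l > 0\<close>
    by (simp add: right_diff_distrib del: sum.lessThan_Suc of_nat_Suc)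
  also have "(\<Sum>k<Suc r. b k) = degen_exp_trunc l r \<alpha> / D"
    by (simp only: trunc b_def sum_divide_distrib)
  \<comment> \<open>The numerators differ by exactly \<open>D\<close>.\<close>
  also have "\<alpha> * (degen_exp l \<alpha> / D) - \<alpha> * (degen_exp_trunc l r \<alpha> / D) = \<alpha>"
    using D by (simp flip: right_diff_distrib diff_divide_distrib D_def)
  also have "real (Suc r) * b (Suc r) = \<alpha> ^ (r + 1) / fact r * (degen_fact 1 (r + 1) l / D)"
    using D by (simp add: b_def a_def field_simps del: of_nat_Suc)
  finally have "?E = 1 / (1 + \<alpha> * l) * (\<alpha> + \<alpha> ^ (r + 1) / fact r * (degen_fact 1 (r + 1) l / D))"
    using \<open>1 + \<alpha> * l > 0\<close> by (simp add: field_simps)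
  with int show ?thesis
    unfolding D_def by (simp add: has_bochner_integral_iff)
qed

end
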